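(* The infinite triangular grid $T_\infty$ satisfies $\varrho_{\mathrm{od}}(T_\infty)=1/3$ and $\chi_{\mathrm{so}}(T_\infty)=3$.
   Context: $T_\infty$ is the $6$-regular infinite plane graph formed by the vertices and edges of the tiling of the plane by congruent equilateral triangles. $N(v)$ is the open neighborhood of $v$. An odd independent set is an independent set $S$ of vertices such that every vertex $v\notin S$ has either $N(v)\cap S=\varnothing$ or $|N(v)\cap S|$ odd. For an infinite plane graph $G$ with a given planar embedding, the odd independence density is $\varrho_{\mathrm{od}}(G):=\sup_S\limsup_{H_n,\ n\to\infty}|S\cap V(H_n)|/|V(H_n)|$, where $S$ ranges over all odd independent sets of $G$ and $H_n$ ranges over all subgraphs induced by the vertices inside axis-parallel squares of size $n$ in the plane. A strong odd coloring is a proper vertex coloring such that for every vertex $v$, each color used in $N(v)$ appears an odd number of times in $N(v)$; $\chi_{\mathrm{so}}(G)$ is the minimum number of colors in a strong odd coloring of $G$. *)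

theory Defs
  imports "HOL-Analysis.Analysis"
begin

record 'a ugraph =
  verts :: "'a set"
  edges :: "'a set set"

definition nbhd :: "'a ugraph \<Rightarrow> 'a \<Rightarrow> 'a set" where
  "nbhd G v = {w. {v, w} \<in> edges G}"

definition independent_set :: "'a ugraph \<Rightarrow> 'a set \<Rightarrow> bool" where
  "independent_set G S \<longleftrightarrow> S \<subseteq> verts G \<and> (\<forall>v\<in>S. \<forall>w\<in>S. {v, w} \<notin> edges G)"

definition odd_independent_set :: "'a ugraph \<Rightarrow> 'a set \<Rightarrow> bool" where
  "odd_independent_set G S \<longleftrightarrow>
     independent_set G S \<and>
     (\<forall>v \<in> verts G - S. nbhd G v \<inter> S = {} \<or> odd (card (nbhd G v \<inter> S)))"

definition proper_coloring :: "'a ugraph \<Rightarrow> ('a \<Rightarrow> 'c) \<Rightarrow> bool" where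
  "proper_coloring G c \<longleftrightarrow>
     (\<forall>v \<in> verts G. \<forall>w \<in> verts G. {v, w} \<in> edges G \<longrightarrow> c v \<noteq> c w)"

definition strong_odd_coloring :: "'a ugraph \<Rightarrow> ('a \<Rightarrow> 'c) \<Rightarrow> bool" where
  "strong_odd_coloring G c \<longleftrightarrow>
     proper_coloring G c \<and>
     (\<forall>v \<in> verts G. \<forall>k \<in> c ` nbhd G v. odd (card {w \<in> nbhd G v. c w = k}))"

text \<open>The value is \<open>\<infinity>\<close> if no strong odd coloring with finitely many colors exists.\<close>

definition strong_odd_chromatic_number :: "'a ugraph \<Rightarrow> enat" where
  "strong_odd_chromatic_number G =
     Inf {enat k | k. \<exists>c :: 'a \<Rightarrow> nat. strong_odd_coloring G c \<and> c ` verts G \<subseteq> {..<k}}"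

text \<open>
  The plane is identified with the complex numbers. The square has side length \<open>n\<close> and
  lower left corner \<open>z\<close>.
\<close>

definition axis_square :: "complex \<Rightarrow> nat \<Rightarrow> complex set" where
  "axis_square z n = cbox z (z + Complex (real n) (real n))"

text \<open>
  The upper limit over all squares whose size tends to infinity, with no restriction on their
  positions, is the \<open>limsup\<close> in \<open>n\<close> of the supremum over all squares of size \<open>n\<close>.
  A square without vertices contributes the ratio \<open>0 / 0 = 0\<close>.
\<close>

definition odd_independence_density :: "complex ugraph \<Rightarrow> ereal" where
  "odd_independence_density G =
     (SUP S \<in> {S. odd_independent_set G S}.
        limsup (\<lambda>n. SUP z. ereal (real (card (S \<inter> axis_square z n)) /
                                  real (card (verts G \<inter> axis_square z n)))))"

text \<open>
  The tiling of the plane by equilateral triangles that has \<open>p\<close> as a vertex and the segment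
  from \<open>p\<close> to \<open>p + u\<close> as an edge. Each tile is represented by the set of its three corners;
  the angles \<open>pi / 3\<close> and \<open>- pi / 3\<close> give the tiles on the two sides of the edge from
  \<open>z\<close> to \<open>z + u\<close>.
\<close>

definition triangular_lattice :: "complex \<Rightarrow> complex \<Rightarrow> complex set" where
  "triangular_lattice p u =
     {p + of_int i * u + of_int j * (u * cis (pi / 3)) | i j. True}"

definition triangular_tiles :: "complex \<Rightarrow> complex \<Rightarrow> complex set set" where
  "triangular_tiles p u =
     {{z, z + u, z + u * cis t} | z t. z \<in> triangular_lattice p u \<and> t \<in> {pi / 3, - pi / 3}}"

definition triangular_grid :: "complex \<Rightarrow> complex \<Rightarrow> complex ugraph" where
  "triangular_grid p u =
     \<lparr> verts = \<Union> (triangular_tiles p u),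
       edges = {{x, y} | x y. x \<noteq> y \<and> (\<exists>T \<in> triangular_tiles p u. x \<in> T \<and> y \<in> T)} \<rparr>"

end

theory Submission
  imports Defs
begin

text \<open>
  In the lattice basis \<open>u\<close>, \<open>u * cis (pi / 3)\<close> the vertices are the points with integer coordinates
  \<open>(i, j)\<close>, and two of them are adjacent iff their difference is one of the six directions
  \<open>(1, 0)\<close>, \<open>(0, 1)\<close>, \<open>(-1, 1)\<close> and their negatives. The function \<open>i - j mod 3\<close> takes the value
  \<open>1\<close> on three of these directions and \<open>2\<close> on the other three. Hence it is a proper coloring in
  which each of the two other colors appears exactly three times around every vertex: a strong
  odd coloring with three colors. Fewer colors do not suffice because the grid contains a triangle.

  The color classes of a strong odd coloring are odd independent sets. Three translates of the
  class of color \<open>0\<close> partition the lattice, so for every size some square contains at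
  least one third of its vertices from this class (\<open>dense_color_class_square\<close>). Since the
  density is a supremum over all positions of the square, this gives the lower bound \<open>1 / 3\<close>
  without any error term.

  For the upper bound, let \<open>S\<close> be independent. The translates of \<open>S\<close> by \<open>0\<close>, \<open>u\<close> and
  \<open>u * cis (pi / 3)\<close> are pairwise disjoint, because the differences of these three vectors are
  edge directions. So three times the number of points of \<open>S\<close> in a square is at most the number
  of vertices in a square enlarged by \<open>norm u\<close> on every side
  (\<open>card_independent_set_square_le\<close>). It remains to see that enlarging the square does
  not matter asymptotically, uniformly in its position: the translates of a half-open fundamental
  parallelogram to the vertices tile the plane, so comparing areas shows that the number of
  vertices in a square of side \<open>s \<ge> 4 * norm u\<close>, times the area of the parallelogram, lies between
  \<open>(s - 4 * norm u)\<^sup>2\<close> and \<open>(s + 4 * norm u)\<^sup>2\<close>. The area itself cancels in the quotient.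
\<close>

section \<open>Lattice coordinates\<close>

text \<open>The lattice point with integer coordinates \<open>(i, j)\<close> relative to the origin \<open>p\<close>.\<close>

definition grid_point :: "complex \<Rightarrow> complex \<Rightarrow> int \<times> int \<Rightarrow> complex" where
  "grid_point p u = (\<lambda>(i, j). p + of_int i * u + of_int j * (u * cis (pi / 3)))"

text \<open>
  The real coordinates of the vector \<open>w\<close> in the basis \<open>u\<close>, \<open>u * cis (pi / 3)\<close>, for \<open>u \<noteq> 0\<close>.
\<close>

definition coord1 :: "complex \<Rightarrow> complex \<Rightarrow> real" where
  "coord1 u w = Re (w / u) - Im (w / u) / sqrt 3"

definition coord2 :: "complex \<Rightarrow> complex \<Rightarrow> real" where
  "coord2 u w = 2 * Im (w / u) / sqrt 3"

text \<open>The coordinate differences between a vertex of the grid and its six neighbors.\<close>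

definition hex_dirs :: "(int \<times> int) set" where
  "hex_dirs = {(1, 0), (0, 1), (-1, 1), (-1, 0), (0, -1), (1, -1)}"

lemma cis_pi_third: "cis (pi / 3) = Complex (1 / 2) (sqrt 3 / 2)"
  by (simp add: complex_eq_iff cos_60 sin_60)

lemma cis_minus_pi_third: "cis (- pi / 3) = 1 - cis (pi / 3)"
  by (simp add: complex_eq_iff cos_60 sin_60)

lemma coords_combination:
  assumes "u \<noteq> 0"
  shows "coord1 u (of_real a * u + of_real b * (u * cis (pi / 3))) = a"
    and "coord2 u (of_real a * u + of_real b * (u * cis (pi / 3))) = b"
proof -
  have "(of_real a * u + of_real b * (u * cis (pi / 3))) / u = of_real a + of_real b * cis (pi / 3)"
    using assms by (simp add: field_simps)
  then show "coord1 u (of_real a * u + of_real b * (u * cis (pi / 3))) = a"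
    and "coord2 u (of_real a * u + of_real b * (u * cis (pi / 3))) = b"
    by (simp_all add: coord1_def coord2_def cis_pi_third)
qed

lemma combination_coords:
  assumes "u \<noteq> 0"
  shows "of_real (coord1 u w) * u + of_real (coord2 u w) * (u * cis (pi / 3)) = w"
proof -
  have "of_real (coord1 u w) + of_real (coord2 u w) * cis (pi / 3) = w / u"
    by (simp add: coord1_def coord2_def cis_pi_third complex_eq_iff)
  then show ?thesis
    using assms by (simp add: field_simps)
qed

lemma coords_add:
  "coord1 u (v + w) = coord1 u v + coord1 u w" "coord2 u (v + w) = coord2 u v + coord2 u w"
  by (simp_all add: coord1_def coord2_def add_divide_distrib)

lemma coords_diff:
  "coord1 u (v - w) = coord1 u v - coord1 u w" "coord2 u (v - w) = coord2 u v - coord2 u w"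
  by (simp_all add: coord1_def coord2_def diff_divide_distrib right_diff_distrib)

lemma coords_grid_point:
  assumes "u \<noteq> 0"
  shows "coord1 u (grid_point p u (i, j) - p) = of_int i"
    and "coord2 u (grid_point p u (i, j) - p) = of_int j"
  using coords_combination[OF assms, of "of_int i" "of_int j"]
  by (simp_all add: grid_point_def)

lemma inj_grid_point:
  assumes "u \<noteq> 0"
  shows "inj (grid_point p u)"
proof (rule injI)
  fix x y assume eq: "grid_point p u x = grid_point p u y"
  obtain i j k l where xy: "x = (i, j)" "y = (k, l)" by fastforce
  have "of_int i = (of_int k :: real)" "of_int j = (of_int l :: real)"
    using coords_grid_point[OF assms, of p] eq xy by metis+
  then show "x = y" using xy by simp
qed

lemma grid_point_eq_iff:
  "u \<noteq> 0 \<Longrightarrow> grid_point p u x = grid_point p u y \<longleftrightarrow> x = y"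
  using inj_grid_point by (auto dest: injD)

lemma grid_point_add:
  "grid_point p u (x + y) = grid_point p u x + grid_point 0 u y"
  by (cases x; cases y) (simp add: grid_point_def algebra_simps)

section \<open>Vertices and edges of the grid\<close>

lemma triangular_lattice_eq: "triangular_lattice p u = range (grid_point p u)"
  by (auto simp: triangular_lattice_def grid_point_def)

text \<open>The lower tile uses \<open>cis (- pi / 3) = 1 - cis (pi / 3)\<close>.\<close>

lemma triangular_tiles_eq:
  "triangular_tiles p u =
     (\<Union>(i, j). {{grid_point p u (i, j), grid_point p u (i + 1, j), grid_point p u (i, j + 1)},
              {grid_point p u (i, j), grid_point p u (i + 1, j), grid_point p u (i + 1, j - 1)}})"
proof -
  have tile: "{grid_point p u (i, j), grid_point p u (i, j) + u, grid_point p u (i, j) + u * cis (pi / 3)} =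
        {grid_point p u (i, j), grid_point p u (i + 1, j), grid_point p u (i, j + 1)}"
    "{grid_point p u (i, j), grid_point p u (i, j) + u, grid_point p u (i, j) + u * cis (- pi / 3)} =
        {grid_point p u (i, j), grid_point p u (i + 1, j), grid_point p u (i + 1, j - 1)}" for i j
    unfolding cis_minus_pi_third by (simp_all add: grid_point_def algebra_simps)
  have "triangular_tiles p u =
     (\<Union>x. {{grid_point p u x, grid_point p u x + u, grid_point p u x + u * cis (pi / 3)},
              {grid_point p u x, grid_point p u x + u, grid_point p u x + u * cis (- pi / 3)}})"
    unfolding triangular_tiles_def triangular_lattice_eq by blast
  also have "\<dots> = (\<Union>(i, j). {{grid_point p u (i, j), grid_point p u (i + 1, j), grid_point p u (i, j + 1)},
              {grid_point p u (i, j), grid_point p u (i + 1, j), grid_point p u (i + 1, j - 1)}})"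
  proof (intro SUP_cong refl)
    fix x :: "int \<times> int"
    obtain i j where "x = (i, j)" by fastforce
    then show "{{grid_point p u x, grid_point p u x + u, grid_point p u x + u * cis (pi / 3)},
              {grid_point p u x, grid_point p u x + u, grid_point p u x + u * cis (- pi / 3)}} =
      (case x of (i, j) \<Rightarrow> {{grid_point p u (i, j), grid_point p u (i + 1, j), grid_point p u (i, j + 1)},
              {grid_point p u (i, j), grid_point p u (i + 1, j), grid_point p u (i + 1, j - 1)}})"
      by (simp only: prod.case tile)
  qed
  finally show ?thesis .
qed

lemma verts_triangular_grid: "verts (triangular_grid p u) = range (grid_point p u)"
proof
  show "verts (triangular_grid p u) \<subseteq> range (grid_point p u)"
    unfolding triangular_grid_def triangular_tiles_eq by auto
  show "range (grid_point p u) \<subseteq> verts (triangular_grid p u)"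
    unfolding triangular_grid_def triangular_tiles_eq by (simp add: image_subset_iff) blast
qed

lemma edge_triangular_grid_iff:
  assumes "u \<noteq> 0"
  shows "{x, y} \<in> edges (triangular_grid p u) \<longleftrightarrow>
           (\<exists>a. \<exists>d\<in>hex_dirs. x = grid_point p u a \<and> y = grid_point p u (a + d))"
    (is "_ \<longleftrightarrow> ?R")
proof
  assume "{x, y} \<in> edges (triangular_grid p u)"
  then obtain T where xy: "x \<noteq> y" "x \<in> T" "y \<in> T" and T: "T \<in> triangular_tiles p u"
    by (auto simp: triangular_grid_def doubleton_eq_iff)
  from T obtain i j where
    "T = {grid_point p u (i, j), grid_point p u (i + 1, j), grid_point p u (i, j + 1)} \<or>
     T = {grid_point p u (i, j), grid_point p u (i + 1, j), grid_point p u (i + 1, j - 1)}"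
    unfolding triangular_tiles_eq by auto
  then obtain a b where ab: "x = grid_point p u a" "y = grid_point p u b"
    and "a \<noteq> b" and "{a, b} \<subseteq> {(i, j), (i + 1, j), (i, j + 1)} \<or> {a, b} \<subseteq> {(i, j), (i + 1, j), (i + 1, j - 1)}"
    using xy by auto
  then have "b - a \<in> hex_dirs"
    by (auto simp: hex_dirs_def)
  then show ?R
    using ab by (intro exI[of _ a] bexI[of _ "b - a"]) auto
next
  assume ?R
  then obtain i j d where d: "d \<in> hex_dirs" and x: "x = grid_point p u (i, j)"
    and y: "y = grid_point p u ((i, j) + d)" by force
  have ne: "x \<noteq> y"
    using d by (auto simp: x y grid_point_eq_iff[OF assms] hex_dirs_def zero_prod_def)
  have "\<exists>T \<in> triangular_tiles p u. x \<in> T \<and> y \<in> T"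
  proof -
    have up: "{grid_point p u (k, l), grid_point p u (k + 1, l), grid_point p u (k, l + 1)} \<in> triangular_tiles p u" 
      for k l unfolding triangular_tiles_eq by blast
    \<comment> \<open>Every edge is a side of an upward tile.\<close>
    have "{(i, j), (i, j) + d} \<subseteq> {(i, j), (i + 1, j), (i, j + 1)} \<or>
      {(i, j), (i, j) + d} \<subseteq> {(i - 1, j), (i - 1 + 1, j), (i - 1, j + 1)} \<or>
      {(i, j), (i, j) + d} \<subseteq> {(i, j - 1), (i + 1, j - 1), (i, j - 1 + 1)}"
      using d unfolding hex_dirs_def by auto
    then obtain k l where "{(i, j), (i, j) + d} \<subseteq> {(k, l), (k + 1, l), (k, l + 1)}"
      by blast
    then have "x \<in> grid_point p u ` {(k, l), (k + 1, l), (k, l + 1)}"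
      "y \<in> grid_point p u ` {(k, l), (k + 1, l), (k, l + 1)}"
      unfolding x y by blast+
    then show ?thesis
      by (intro bexI[OF _ up[of k l]]) simp
  qed
  with ne show "{x, y} \<in> edges (triangular_grid p u)"
    by (auto simp: triangular_grid_def)
qed

lemma nbhd_triangular_grid:
  assumes "u \<noteq> 0"
  shows "nbhd (triangular_grid p u) (grid_point p u a) = (\<lambda>d. grid_point p u (a + d)) ` hex_dirs"
  by (auto simp: nbhd_def edge_triangular_grid_iff[OF assms] grid_point_eq_iff[OF assms])

section \<open>The three-coloring\<close>

text \<open>
  The coloring \<open>i - j mod 3\<close> of the lattice points. The floors only serve to make it a total
  function on the plane; on the lattice the coordinates are integers.
\<close>

definition grid_coloring :: "complex \<Rightarrow> complex \<Rightarrow> complex \<Rightarrow> nat" where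
  "grid_coloring p u z = nat ((\<lfloor>coord1 u (z - p)\<rfloor> - \<lfloor>coord2 u (z - p)\<rfloor>) mod 3)"

lemma grid_coloring_grid_point:
  assumes "u \<noteq> 0"
  shows "grid_coloring p u (grid_point p u (i, j)) = nat ((i - j) mod 3)"
  by (simp add: grid_coloring_def coords_grid_point[OF assms])

lemma grid_coloring_less: "grid_coloring p u z < 3"
  by (simp add: grid_coloring_def nat_less_iff)

lemma strong_odd_grid_coloring:
  assumes "u \<noteq> 0"
  shows "strong_odd_coloring (triangular_grid p u) (grid_coloring p u)"
proof -
  let ?G = "triangular_grid p u" and ?c = "grid_coloring p u"
  have mod3: "nat (x mod 3) = nat (y mod 3) \<longleftrightarrow> x mod 3 = y mod 3" for x y :: int
    by (simp add: eq_nat_nat_iff)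
  have proper: "proper_coloring ?G ?c"
    unfolding proper_coloring_def edge_triangular_grid_iff[OF assms]
  proof (intro ballI impI)
    fix v w assume "\<exists>a. \<exists>d\<in>hex_dirs. v = grid_point p u a \<and> w = grid_point p u (a + d)"
    then obtain a d where d: "d \<in> hex_dirs" and v: "v = grid_point p u a"
      and w: "w = grid_point p u (a + d)" by blast
    obtain i j k l where a: "a = (i, j)" and kl: "d = (k, l)"
      by (metis surj_pair)
    have "\<not> 3 dvd l - k"
      using d by (auto simp: kl hex_dirs_def)
    moreover have "i - j - (i + k - (j + l)) = l - k" by simp
    ultimately have "(i - j) mod 3 \<noteq> (i + k - (j + l)) mod 3"
      by (simp only: mod_eq_dvd_iff not_False_eq_True)
    then show "?c v \<noteq> ?c w"
      by (simp add: v w a kl grid_coloring_grid_point[OF assms] mod3)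
  qed
  have "odd (card {w \<in> nbhd ?G v. ?c w = k})"
    if "v \<in> verts ?G" "k \<in> ?c ` nbhd ?G v" for v k
  proof -
    obtain i j where v: "v = grid_point p u (i, j)"
      using \<open>v \<in> verts ?G\<close> unfolding verts_triangular_grid by force
    \<comment> \<open>The directions along which \<open>i - j\<close> changes by \<open>1\<close> and by \<open>2\<close> modulo \<open>3\<close>.\<close>
    define A :: "(int \<times> int) set" where "A = {(1, 0), (-1, 1), (0, -1)}"
    define B :: "(int \<times> int) set" where "B = {(0, 1), (-1, 0), (1, -1)}"
    have AB: "hex_dirs = A \<union> B"
      unfolding hex_dirs_def A_def B_def by blast
    define f where "f = (\<lambda>d. grid_point p u ((i, j) + d))"
    have N: "nbhd ?G v = f ` A \<union> f ` B"
      unfolding v nbhd_triangular_grid[OF assms] AB f_def by (rule image_Un)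
    have cf: "?c (f (k, l)) = nat ((i - j + (k - l)) mod 3)" for k l
      by (simp add: f_def grid_coloring_grid_point[OF assms] algebra_simps)
    have cA: "?c w = nat ((i - j + 1) mod 3)" if "w \<in> f ` A" for w
    proof -
      have "(k - l) mod 3 = 1 mod 3" if "(k, l) \<in> A" for k l
        using that by (auto simp: A_def)
      then have "(i - j + (k - l)) mod 3 = (i - j + 1) mod 3" if "(k, l) \<in> A" for k l
        using that by (intro mod_add_cong refl)
      then show ?thesis
        using that by (auto simp: cf)
    qed
    have cB: "?c w = nat ((i - j + 2) mod 3)" if "w \<in> f ` B" for w
    proof -
      have "(k - l) mod 3 = 2 mod 3" if "(k, l) \<in> B" for k l
        using that by (auto simp: B_def)
      then have "(i - j + (k - l)) mod 3 = (i - j + 2) mod 3" if "(k, l) \<in> B" for k l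
        using that by (intro mod_add_cong refl)
      then show ?thesis
        using that by (auto simp: cf)
    qed
    have ne: "nat ((i - j + 1) mod 3) \<noteq> nat ((i - j + 2) mod 3)"
      unfolding mod3 by (simp add: mod_eq_dvd_iff)
    have "k = nat ((i - j + 1) mod 3) \<or> k = nat ((i - j + 2) mod 3)"
      using that(2) unfolding N using cA cB by blast
    then have "{w \<in> nbhd ?G v. ?c w = k} = f ` A \<or> {w \<in> nbhd ?G v. ?c w = k} = f ` B"
      unfolding N using cA cB ne by auto
    moreover have "inj f"
      by (auto simp: inj_def f_def grid_point_eq_iff[OF assms])
    then have "card (f ` A) = card A" "card (f ` B) = card B"
      by (auto intro: card_image inj_on_subset)
    then have "card (f ` A) = 3" "card (f ` B) = 3"
      by (simp_all add: A_def B_def)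
    ultimately show ?thesis by auto
  qed
  with proper show ?thesis
    unfolding strong_odd_coloring_def by blast
qed

lemma color_class_odd_independent:
  assumes "strong_odd_coloring G c" and "\<And>v. v \<in> verts G \<Longrightarrow> nbhd G v \<subseteq> verts G"
  shows "odd_independent_set G {v \<in> verts G. c v = k}"
proof -
  let ?S = "{v \<in> verts G. c v = k}"
  have "independent_set G ?S"
    using assms(1) unfolding independent_set_def strong_odd_coloring_def proper_coloring_def
    by (metis (mono_tags, lifting) mem_Collect_eq subsetI)
  moreover have "nbhd G v \<inter> ?S = {} \<or> odd (card (nbhd G v \<inter> ?S))" if "v \<in> verts G" for v
  proof -
    have eq: "nbhd G v \<inter> ?S = {w \<in> nbhd G v. c w = k}"
      using assms(2)[OF that] by auto
    show ?thesis
      using assms(1) that unfolding eq strong_odd_coloring_def by auto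
  qed
  ultimately show ?thesis
    unfolding odd_independent_set_def by auto
qed

lemma odd_independent_grid_color_class:
  assumes "u \<noteq> 0"
  shows "odd_independent_set (triangular_grid p u) {v \<in> range (grid_point p u). grid_coloring p u v = k}"
proof -
  have "nbhd (triangular_grid p u) v \<subseteq> verts (triangular_grid p u)"
    if "v \<in> verts (triangular_grid p u)" for v
  proof -
    obtain a where v: "v = grid_point p u a"
      using \<open>v \<in> verts (triangular_grid p u)\<close> unfolding verts_triangular_grid by blast
    show ?thesis
      unfolding v nbhd_triangular_grid[OF assms] verts_triangular_grid by blast
  qed
  then show ?thesis
    using color_class_odd_independent[OF strong_odd_grid_coloring[OF assms], of p k]
    unfolding verts_triangular_grid by blast
qed

lemma strong_odd_chromatic_number_triangular_grid:
  assumes "u \<noteq> 0"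
  shows "strong_odd_chromatic_number (triangular_grid p u) = 3"
proof -
  let ?G = "triangular_grid p u"
  have three: "(3 :: enat) = enat 3" by (simp add: numeral_eq_enat)
  show ?thesis
    unfolding strong_odd_chromatic_number_def
  proof (rule antisym)
    show "Inf {enat k |k. \<exists>c :: complex \<Rightarrow> nat. strong_odd_coloring ?G c \<and> c ` verts ?G \<subseteq> {..<k}} \<le> 3"
      unfolding three
      by (rule Inf_lower) (use strong_odd_grid_coloring[OF assms] grid_coloring_less in blast)
    show "3 \<le> Inf {enat k |k. \<exists>c :: complex \<Rightarrow> nat. strong_odd_coloring ?G c \<and> c ` verts ?G \<subseteq> {..<k}}"
    proof (rule Inf_greatest)
      fix x
      assume "x \<in> {enat k |k. \<exists>c :: complex \<Rightarrow> nat. strong_odd_coloring ?G c \<and> c ` verts ?G \<subseteq> {..<k}}"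
      then obtain k and c :: "complex \<Rightarrow> nat"
        where x: "x = enat k" and c: "strong_odd_coloring ?G c" and img: "c ` verts ?G \<subseteq> {..<k}"
        by blast
      let ?x = "grid_point p u (0, 0)" and ?y = "grid_point p u (1, 0)" and ?z = "grid_point p u (0, 1)"
      have edges: "{?x, ?y} \<in> edges ?G" "{?x, ?z} \<in> edges ?G" "{?y, ?z} \<in> edges ?G"
        by (simp_all add: edge_triangular_grid_iff[OF assms] grid_point_eq_iff[OF assms] hex_dirs_def zero_prod_def)
      have "c ?x \<noteq> c ?y" "c ?x \<noteq> c ?z" "c ?y \<noteq> c ?z"
        using c edges unfolding strong_odd_coloring_def proper_coloring_def verts_triangular_grid
        by blast+
      then have "3 = card {c ?x, c ?y, c ?z}" by simp
      also have "\<dots> \<le> card {..<k}"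
        using img unfolding verts_triangular_grid by (intro card_mono) auto
      finally have "3 \<le> k" by simp
      then show "3 \<le> x"
        unfolding x three by simp
    qed
  qed
qed


section \<open>Counting lattice points in squares\<close>

text \<open>
  The closed axis-parallel square with lower left corner \<open>z\<close> and side length \<open>s\<close>. Real side lengths
  are needed because squares are enlarged and shrunk by multiples of \<open>norm u\<close>.
\<close>

definition square :: "complex \<Rightarrow> real \<Rightarrow> complex set" where
  "square z s = cbox z (z + Complex s s)"

lemma mem_square: "w \<in> square z s \<longleftrightarrow>
   Re z \<le> Re w \<and> Re w \<le> Re z + s \<and> Im z \<le> Im w \<and> Im w \<le> Im z + s"
  by (auto simp: square_def in_cbox_complex_iff)

lemma axis_square_eq: "axis_square z n = square z (real n)"
  by (simp add: axis_square_def square_def)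

lemma add_mem_square:
  assumes "w \<in> square z s" "norm d \<le> r"
  shows "w + d \<in> square (z - Complex r r) (s + 2 * r)"
  using assms abs_Re_le_cmod[of d] abs_Im_le_cmod[of d] by (auto simp: mem_square)

lemma add_mem_square_iff: "w + a \<in> square (z + a) s \<longleftrightarrow> w \<in> square z s"
  by (auto simp: mem_square)

lemma measure_square:
  assumes "s \<ge> 0"
  shows "measure lebesgue (square z s) = s\<^sup>2"
proof -
  have "measure lebesgue (square z s) = (\<Prod>i\<in>Basis. (z + Complex s s) \<bullet> i - z \<bullet> i)"
    unfolding square_def using assms
    by (subst measure_completion, simp, intro content_cbox) (auto simp: Basis_complex_def inner_add_left)
  also have "\<dots> = s\<^sup>2"
    by (simp add: Basis_complex_def inner_add_left power2_eq_square)
  finally show ?thesis .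
qed

lemma continuous_on_coords:
  "continuous_on S (\<lambda>w. coord1 u (f w))" "continuous_on S (\<lambda>w. coord2 u (f w))"
  if "continuous_on S f"
  unfolding coord1_def coord2_def divide_complex_def divide_inverse
  by (intro continuous_intros that)+

lemma finite_grid_points_square:
  assumes "u \<noteq> 0"
  shows "finite (range (grid_point p u) \<inter> square z s)"
proof -
  have "bounded ((\<lambda>w. coord1 u (w - p)) ` square z s)" "bounded ((\<lambda>w. coord2 u (w - p)) ` square z s)"
    unfolding square_def
    by (intro compact_imp_bounded compact_continuous_image continuous_on_coords
        continuous_intros compact_cbox)+
  then obtain M N where M: "\<And>w. w \<in> square z s \<Longrightarrow> \<bar>coord1 u (w - p)\<bar> \<le> M"
    and N: "\<And>w. w \<in> square z s \<Longrightarrow> \<bar>coord2 u (w - p)\<bar> \<le> N"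
    unfolding bounded_iff by auto
  have "range (grid_point p u) \<inter> square z s \<subseteq>
      grid_point p u ` ({-\<lceil>M\<rceil>..\<lceil>M\<rceil>} \<times> {-\<lceil>N\<rceil>..\<lceil>N\<rceil>})"
  proof
    fix w assume w: "w \<in> range (grid_point p u) \<inter> square z s"
    then obtain i j where ij: "w = grid_point p u (i, j)" by fastforce
    have "\<bar>real_of_int i\<bar> \<le> M" "\<bar>real_of_int j\<bar> \<le> N"
      using M[of w] N[of w] w unfolding ij by (simp_all add: coords_grid_point[OF assms])
    then have "\<bar>i\<bar> \<le> \<lceil>M\<rceil>" "\<bar>j\<bar> \<le> \<lceil>N\<rceil>"
      by linarith+
    then show "w \<in> grid_point p u ` ({-\<lceil>M\<rceil>..\<lceil>M\<rceil>} \<times> {-\<lceil>N\<rceil>..\<lceil>N\<rceil>})"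
      unfolding ij by (intro imageI) auto
  qed
  then show ?thesis
    by (rule finite_subset) simp
qed

text \<open>
  The fundamental parallelogram of the lattice, half-open so that its translates to the lattice
  points partition the plane.
\<close>

definition cell :: "complex \<Rightarrow> complex set" where
  "cell u = {w. coord1 u w \<in> {0..<1} \<and> coord2 u w \<in> {0..<1}}"

lemma norm_cell:
  assumes "u \<noteq> 0" "w \<in> cell u"
  shows "norm w \<le> 2 * norm u"
proof -
  have "norm w \<le> norm (of_real (coord1 u w) * u) + norm (of_real (coord2 u w) * (u * cis (pi / 3)))"
    by (metis combination_coords[OF assms(1)] norm_triangle_ineq)
  also have "\<dots> = \<bar>coord1 u w\<bar> * norm u + \<bar>coord2 u w\<bar> * norm u"
    by (simp add: norm_mult)
  also have "\<dots> \<le> 1 * norm u + 1 * norm u"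
    using assms(2) by (intro add_mono mult_right_mono) (auto simp: cell_def)
  finally show ?thesis by simp
qed

lemma lmeasurable_cell:
  assumes "u \<noteq> 0"
  shows "cell u \<in> lmeasurable"
proof (rule bounded_set_imp_lmeasurable)
  show "bounded (cell u)"
    using norm_cell[OF assms] unfolding bounded_iff by blast
  have [measurable]: "coord1 u \<in> borel_measurable borel" "coord2 u \<in> borel_measurable borel"
    by (intro borel_measurable_continuous_onI continuous_on_coords continuous_on_id)+
  have "cell u \<in> sets borel"
    unfolding cell_def by measurable
  then show "cell u \<in> sets lebesgue"
    by (simp add: sets_completionI_sets)
qed

lemma disjoint_cells:
  assumes "u \<noteq> 0"
  shows "pairwise (\<lambda>x y. disjnt ((+) x ` cell u) ((+) y ` cell u)) (range (grid_point p u))"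
proof -
  have "x = y" if xy: "x \<in> range (grid_point p u)" "y \<in> range (grid_point p u)"
    and vw: "v \<in> cell u" "w \<in> cell u" "x + v = y + w" for x y v w
  proof -
    obtain i j k l where ij: "x = grid_point p u (i, j)" and kl: "y = grid_point p u (k, l)"
      using xy by (metis rangeE surj_pair)
    have eq: "(x - p) + v = (y - p) + w"
      using vw by simp
    have "of_int i + coord1 u v = of_int k + coord1 u w"
      using arg_cong[OF eq, of "coord1 u"]
      unfolding coords_add ij kl coords_grid_point[OF assms] .
    moreover have "of_int j + coord2 u v = of_int l + coord2 u w"
      using arg_cong[OF eq, of "coord2 u"]
      unfolding coords_add ij kl coords_grid_point[OF assms] .
    ultimately have "i = k" "j = l"
      using vw(1,2) unfolding cell_def by auto
    then show ?thesis
      unfolding ij kl by simp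
  qed
  then show ?thesis
    unfolding pairwise_def disjnt_iff by blast
qed

lemma cells_cover:
  assumes "u \<noteq> 0"
  obtains x where "x \<in> range (grid_point p u)" "w \<in> (+) x ` cell u"
proof
  let ?x = "grid_point p u (\<lfloor>coord1 u (w - p)\<rfloor>, \<lfloor>coord2 u (w - p)\<rfloor>)"
  have eq: "w - ?x = (w - p) - (?x - p)" by simp
  have "coord1 u (w - ?x) = coord1 u (w - p) - \<lfloor>coord1 u (w - p)\<rfloor>"
    "coord2 u (w - ?x) = coord2 u (w - p) - \<lfloor>coord2 u (w - p)\<rfloor>"
    unfolding eq coords_diff(1)[of u "w - p"] coords_diff(2)[of u "w - p"] coords_grid_point[OF assms]
    by simp_all
  then have "w - ?x \<in> cell u"
    unfolding cell_def by simp linarith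
  then show "w \<in> (+) ?x ` cell u"
    by (metis add.commute diff_add_cancel image_eqI)
qed simp

lemma measure_cells:
  assumes "u \<noteq> 0" and "X \<subseteq> range (grid_point p u)" and "finite X"
  shows "(\<Union>x\<in>X. (+) x ` cell u) \<in> lmeasurable"
    and "measure lebesgue (\<Union>x\<in>X. (+) x ` cell u) = measure lebesgue (cell u) * card X"
proof -
  have meas: "(+) x ` cell u \<in> lmeasurable" for x
    by (intro measurable_translation lmeasurable_cell assms)
  then show "(\<Union>x\<in>X. (+) x ` cell u) \<in> lmeasurable"
    using assms(3) by (intro fmeasurable.finite_UN) auto
  have "measure lebesgue (\<Union>x\<in>X. (+) x ` cell u) = (\<Sum>x\<in>X. measure lebesgue ((+) x ` cell u))"
    by (rule measure_UNION'[OF assms(3) meas])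
      (rule pairwise_subset[OF disjoint_cells[OF assms(1)] assms(2)])
  then show "measure lebesgue (\<Union>x\<in>X. (+) x ` cell u) = measure lebesgue (cell u) * card X"
    by (simp add: measure_translation)
qed

lemma card_grid_points_square_le:
  assumes "u \<noteq> 0" "s \<ge> 0"
  shows "measure lebesgue (cell u) * card (range (grid_point p u) \<inter> square z s) \<le> (s + 4 * norm u)\<^sup>2"
proof -
  let ?X = "range (grid_point p u) \<inter> square z s"
  let ?Q = "square (z - Complex (2 * norm u) (2 * norm u)) (s + 2 * (2 * norm u))"
  note cells = measure_cells[OF assms(1) Int_lower1 finite_grid_points_square[OF assms(1)], of p z s]
  have "(\<Union>x\<in>?X. (+) x ` cell u) \<subseteq> ?Q"
    using add_mem_square norm_cell[OF assms(1)] by blast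
  then have "measure lebesgue (\<Union>x\<in>?X. (+) x ` cell u) \<le> measure lebesgue ?Q"
    using cells(1) by (intro measure_mono_fmeasurable) (auto simp: square_def)
  then show ?thesis
    unfolding cells(2) using assms(2) by (simp add: measure_square)
qed

lemma card_grid_points_square_ge:
  assumes "u \<noteq> 0" "s \<ge> 4 * norm u"
  shows "(s - 4 * norm u)\<^sup>2 \<le> measure lebesgue (cell u) * card (range (grid_point p u) \<inter> square z s)"
proof -
  let ?X = "range (grid_point p u) \<inter> square z s"
  let ?Q = "square (z + Complex (2 * norm u) (2 * norm u)) (s - 4 * norm u)"
  note cells = measure_cells[OF assms(1) Int_lower1 finite_grid_points_square[OF assms(1)], of p z s]
  have "?Q \<subseteq> (\<Union>x\<in>?X. (+) x ` cell u)"
  proof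
    fix w assume w: "w \<in> ?Q"
    obtain x where x: "x \<in> range (grid_point p u)" "w \<in> (+) x ` cell u"
      using cells_cover[OF assms(1)] .
    then obtain d where d: "d \<in> cell u" "w = x + d" by blast
    have "w + - d \<in> square z s"
      using add_mem_square[OF w, of "- d" "2 * norm u"] norm_cell[OF assms(1) d(1)] by simp
    then show "w \<in> (\<Union>x\<in>?X. (+) x ` cell u)"
      using x d by auto
  qed
  then have "measure lebesgue ?Q \<le> measure lebesgue (\<Union>x\<in>?X. (+) x ` cell u)"
    using cells(1) by (intro measure_mono_fmeasurable) (auto simp: square_def)
  then show ?thesis
    unfolding cells(2) using assms(2) by (simp add: measure_square)
qed

section \<open>Independent sets and color classes in squares\<close>

lemma card_independent_set_square_le:
  assumes "u \<noteq> 0" and S: "independent_set (triangular_grid p u) S"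
  shows "3 * card (S \<inter> square z s) \<le>
    card (range (grid_point p u) \<inter> square (z - Complex (norm u) (norm u)) (s + 2 * norm u))"
proof -
  let ?V = "range (grid_point p u)" and ?Q = "square (z - Complex (norm u) (norm u)) (s + 2 * norm u)"
  \<comment> \<open>The corners of a tile at the origin; their nonzero differences are edge directions.\<close>
  define D :: "(int \<times> int) set" where "D = {(0, 0), (1, 0), (0, 1)}"
  define A where "A = (\<lambda>d. (\<lambda>x. x + grid_point 0 u d) ` (S \<inter> square z s))"
  have sub: "S \<subseteq> ?V"
    using S unfolding independent_set_def verts_triangular_grid by blast
  have fin: "finite (S \<inter> square z s)"
    by (rule finite_subset[OF _ finite_grid_points_square[OF assms(1), of p z s]]) (use sub in blast)
  have cardA: "card (A d) = card (S \<inter> square z s)" for d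
    unfolding A_def by (intro card_image) (auto simp: inj_on_def)
  have AVQ: "A d \<subseteq> ?V \<inter> ?Q" if "d \<in> D" for d
  proof -
    have "norm (grid_point 0 u d) \<le> norm u"
      using that by (auto simp: D_def grid_point_def norm_mult)
    then have "A d \<subseteq> ?Q"
      unfolding A_def using add_mem_square by blast
    moreover have "A d \<subseteq> ?V"
      unfolding A_def using sub by (auto simp flip: grid_point_add)
    ultimately show ?thesis by blast
  qed
  have disj: "A d \<inter> A e = {}" if de: "d \<in> D" "e \<in> D" "d \<noteq> e" for d e
  proof (rule ccontr)
    assume "A d \<inter> A e \<noteq> {}"
    then obtain x y where "x \<in> S" "y \<in> S" and eq: "x + grid_point 0 u d = y + grid_point 0 u e"
      unfolding A_def by blast
    moreover from this obtain a b where ab: "x = grid_point p u a" "y = grid_point p u b"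
      using sub by blast
    ultimately have "a + d = b + e"
      by (simp add: grid_point_eq_iff[OF assms(1)] flip: grid_point_add)
    then have "b = a + (d - e)"
      by (metis add_diff_cancel add_diff_eq)
    moreover have "d - e \<in> hex_dirs"
      using de by (auto simp: D_def hex_dirs_def)
    ultimately have "{x, y} \<in> edges (triangular_grid p u)"
      unfolding edge_triangular_grid_iff[OF assms(1)] ab by blast
    then show False
      using S \<open>x \<in> S\<close> \<open>y \<in> S\<close> unfolding independent_set_def by blast
  qed
  have "3 * card (S \<inter> square z s) = (\<Sum>d\<in>D. card (A d))"
    by (simp add: cardA D_def)
  also have "\<dots> = card (\<Union>d\<in>D. A d)"
    by (rule card_UN_disjoint[symmetric]) (use disj fin in \<open>auto simp: D_def A_def\<close>)
  also have "\<dots> \<le> card (?V \<inter> ?Q)"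
    using AVQ by (intro card_mono finite_grid_points_square[OF assms(1)]) blast
  finally show ?thesis .
qed

lemma translate_Int_square:
  "(\<lambda>x. x + a) ` (X \<inter> square z s) = (\<lambda>x. x + a) ` X \<inter> square (z + a) s"
  by (auto simp: add_mem_square_iff)

lemma card_translate_Int_square:
  "card ((\<lambda>x. x + a) ` X \<inter> square (z + a) s) = card (X \<inter> square z s)"
  unfolding translate_Int_square[symmetric] by (intro card_image) (auto simp: inj_on_def)

lemma translate_grid_points:
  "(\<lambda>x. x + grid_point 0 u d) ` range (grid_point p u) = range (grid_point p u)"
proof -
  have "grid_point p u b \<in> (\<lambda>x. x + grid_point 0 u d) ` range (grid_point p u)" for b
    using grid_point_add[of p u "b - d" d] by (intro image_eqI[of _ _ "grid_point p u (b - d)"]) auto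
  then show ?thesis
    by (auto simp flip: grid_point_add)
qed

text \<open>Moving by \<open>(- k, 0)\<close> lowers the color \<open>i - j\<close> by \<open>k\<close>.\<close>

lemma translate_grid_color_class:
  fixes k :: nat
  assumes "u \<noteq> 0" "k < 3"
  shows "(\<lambda>x. x + grid_point 0 u (- int k, 0)) ` {v \<in> range (grid_point p u). grid_coloring p u v = k} =
    {v \<in> range (grid_point p u). grid_coloring p u v = 0}" (is "?t ` ?A = ?B")
proof -
  have col: "grid_coloring p u (grid_point p u a) = k \<longleftrightarrow> grid_coloring p u (grid_point p u a + grid_point 0 u (- int k, 0)) = 0" for a
  proof -
    obtain i j where a: "a = (i, j)" by fastforce
    have "nat ((i - j) mod 3) = k \<longleftrightarrow> (i - j) mod 3 = int k"
      by (simp add: nat_eq_iff)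
    also have "\<dots> \<longleftrightarrow> (i - int k - j) mod 3 = 0"
    proof -
      have "(i - j) mod 3 = int k \<longleftrightarrow> (i - j) mod 3 = int k mod 3"
        using assms(2) by simp
      moreover have "i - int k - j = i - j - int k" by simp
      ultimately show ?thesis
        by (simp only: mod_eq_dvd_iff dvd_eq_mod_eq_0)
    qed
    also have "\<dots> \<longleftrightarrow> nat ((i - int k - j) mod 3) = 0"
      using pos_mod_sign[of 3 "i - int k - j"] by linarith
    finally have "nat ((i - j) mod 3) = k \<longleftrightarrow> nat ((i - int k - j) mod 3) = 0" .
    then show ?thesis
      unfolding grid_point_add[symmetric] a add_Pair add_0_right
        grid_coloring_grid_point[OF assms(1)] by simp
  qed
  have "?B = {v \<in> ?t ` range (grid_point p u). grid_coloring p u v = 0}"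
    unfolding translate_grid_points by simp
  also have "\<dots> = ?t ` ?A"
    using col by auto
  finally show ?thesis by simp
qed

text \<open>
  In the square at \<open>p\<close> some color \<open>k\<close> is used on at least one third of the vertices; the translation that
  takes color \<open>k\<close> to color \<open>0\<close> takes this square to the desired one.
\<close>

lemma dense_color_class_square:
  assumes "u \<noteq> 0"
  obtains z where
    "card (range (grid_point p u) \<inter> square z s) \<le>
       3 * card ({v \<in> range (grid_point p u). grid_coloring p u v = 0} \<inter> square z s)"
proof -
  let ?V = "range (grid_point p u)"
  define A where "A = (\<lambda>k. {v \<in> ?V. grid_coloring p u v = k})"
  have "?V \<inter> square p s = (\<Union>k<3. A k \<inter> square p s)"
    using grid_coloring_less by (auto simp: A_def)
  then have "card (?V \<inter> square p s) \<le> (\<Sum>k<3. card (A k \<inter> square p s))"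
    by (simp only:) (rule card_UN_le, simp)
  also have "\<dots> = card (A 0 \<inter> square p s) + card (A 1 \<inter> square p s) + card (A 2 \<inter> square p s)"
    by (simp add: numeral_3_eq_3 numeral_2_eq_2)
  finally have "card (?V \<inter> square p s) \<le> 3 * card (A 0 \<inter> square p s) \<or>
    card (?V \<inter> square p s) \<le> 3 * card (A 1 \<inter> square p s) \<or>
    card (?V \<inter> square p s) \<le> 3 * card (A 2 \<inter> square p s)"
    by linarith
  then obtain k :: nat where k: "k < 3" "card (?V \<inter> square p s) \<le> 3 * card (A k \<inter> square p s)"
    by (elim disjE) (erule that[rotated], simp)+
  show ?thesis
  proof
    let ?a = "grid_point 0 u (- int k, 0)"
    have "card (?V \<inter> square (p + ?a) s) = card (?V \<inter> square p s)"
      using card_translate_Int_square[of ?a ?V p s] unfolding translate_grid_points .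
    moreover have "card (A 0 \<inter> square (p + ?a) s) = card (A k \<inter> square p s)"
      using card_translate_Int_square[of ?a "A k" p s]
      unfolding A_def translate_grid_color_class[OF assms k(1)] .
    ultimately show "card (?V \<inter> square (p + ?a) s) \<le> 3 * card ({v \<in> ?V. grid_coloring p u v = 0} \<inter> square (p + ?a) s)"
      using k(2) by (simp add: A_def)
  qed
qed

section \<open>The density\<close>

lemma odd_independence_density_triangular_grid:
  assumes "u \<noteq> 0"
  shows "odd_independence_density (triangular_grid p u) = 1 / 3"
proof -
  let ?V = "range (grid_point p u)"
  define ratio where "ratio = (\<lambda>S n z. ereal (real (card (S \<inter> square z (real n))) /
                                  real (card (?V \<inter> square z (real n)))))"
  define A where "A = measure lebesgue (cell u)"
  have dens: "odd_independence_density (triangular_grid p u) =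
    (SUP S \<in> {S. odd_independent_set (triangular_grid p u) S}. limsup (\<lambda>n. SUP z. ratio S n z))"
    unfolding odd_independence_density_def ratio_def axis_square_eq verts_triangular_grid ..
  have large: "\<forall>\<^sub>F n in sequentially. real n > 4 * norm u"
    by (rule filterlim_at_top_dense[THEN iffD1, rule_format, OF filterlim_real_sequentially])
  have count: "(real n - 4 * norm u)\<^sup>2 \<le> A * card (?V \<inter> square z (real n))"
    if "real n > 4 * norm u" for n z
    using card_grid_points_square_ge[OF assms(1)] that unfolding A_def by simp
  have pos: "A * card (?V \<inter> square z (real n)) > 0" if "real n > 4 * norm u" for n z
    using count[OF that, of z] that by (smt (verit) zero_less_power)
  have upper: "limsup (\<lambda>n. SUP z. ratio S n z) \<le> 1 / 3"
    if S: "odd_independent_set (triangular_grid p u) S" for S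
  proof -
    have indep: "independent_set (triangular_grid p u) S"
      using S unfolding odd_independent_set_def by simp
    \<comment> \<open>The \<open>6\<close> is \<open>2\<close> from enlarging the square plus \<open>4\<close> from the upper bound on its area count.\<close>
    define g where "g = (\<lambda>n. (real n + 6 * norm u)\<^sup>2 / (real n - 4 * norm u)\<^sup>2 / 3)"
    have "ratio S n z \<le> ereal (g n)" if n: "real n > 4 * norm u" for n z
    proof -
      let ?W = "?V \<inter> square (z - Complex (norm u) (norm u)) (real n + 2 * norm u)"
      define a b c where "a = real (card (S \<inter> square z (real n)))"
        and "b = real (card (?V \<inter> square z (real n)))" and "c = real (card ?W)"
      define P R where "P = (real n + 6 * norm u)\<^sup>2" and "R = (real n - 4 * norm u)\<^sup>2"
      have "3 * a \<le> c"
        unfolding a_def c_def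
        using card_independent_set_square_le[OF assms indep, of z "real n"] by linarith
      moreover have "A * c \<le> P"
        using card_grid_points_square_le[OF assms, of "real n + 2 * norm u" p "z - Complex (norm u) (norm u)"]
        by (simp add: A_def c_def P_def add.commute)
      moreover have R: "0 < R" "R \<le> A * b" and "0 < A * b"
        using n count pos by (simp_all add: R_def b_def)
      moreover have "b \<ge> 0" "a \<ge> 0" "A \<ge> 0"
        by (simp_all add: b_def a_def A_def)
      ultimately have b: "b > 0"
        by (simp add: zero_less_mult_iff)
      have "(3 * a) * R \<le> c * (A * b)"
        using \<open>3 * a \<le> c\<close> R \<open>a \<ge> 0\<close> by (intro mult_mono) auto
      also have "\<dots> = (A * c) * b" by simp
      also have "\<dots> \<le> P * b"
        using \<open>A * c \<le> P\<close> b by (intro mult_right_mono) auto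
      finally have "a / b \<le> P / R / 3"
        using b R(1) by (simp add: field_simps)
      then show ?thesis
        by (simp add: ratio_def g_def a_def b_def P_def R_def)
    qed
    then have "\<forall>\<^sub>F n in sequentially. (SUP z. ratio S n z) \<le> ereal (g n)"
      using large by (auto elim!: eventually_mono intro!: SUP_least)
    then have "limsup (\<lambda>n. SUP z. ratio S n z) \<le> limsup (\<lambda>n. ereal (g n))"
      by (rule Limsup_mono)
    also have "g \<longlonglongrightarrow> 1 / 3"
    proof -
      have "filterlim (\<lambda>n. - (4 * norm u) + real n) at_top sequentially"
        by (rule filterlim_tendsto_add_at_top[OF tendsto_const filterlim_real_sequentially])
      then have "(\<lambda>n. 10 * norm u / (- (4 * norm u) + real n)) \<longlonglongrightarrow> 0"
        by (rule real_tendsto_divide_at_top[OF tendsto_const])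
      then have "(\<lambda>n. (1 + 10 * norm u / (- (4 * norm u) + real n))\<^sup>2 / 3) \<longlonglongrightarrow> (1 + 0)\<^sup>2 / 3"
        by (intro tendsto_intros) auto
      moreover have "\<forall>\<^sub>F n in sequentially. (1 + 10 * norm u / (- (4 * norm u) + real n))\<^sup>2 / 3 = g n"
        using large
      proof eventually_elim
        case (elim n)
        then have "1 + 10 * norm u / (- (4 * norm u) + real n) = (real n + 6 * norm u) / (real n - 4 * norm u)"
          by (simp add: field_simps)
        then show ?case
          by (simp add: g_def power_divide)
      qed
      ultimately show ?thesis
        by (auto intro: Lim_transform_eventually)
    qed
    then have "limsup (\<lambda>n. ereal (g n)) = 1 / 3"
      by (intro lim_imp_Limsup) (auto simp: one_ereal_def)
    finally show ?thesis .
  qed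
  \<comment> \<open>The color class \<open>S\<close> witnesses the lower bound: some square of each large size has
    at least a third of its vertices in \<open>S\<close>.\<close>
  define S where "S = {v \<in> ?V. grid_coloring p u v = 0}"
  have "1 / 3 \<le> (SUP z. ratio S n z)" if n: "real n > 4 * norm u" for n
  proof -
    obtain z where z: "card (?V \<inter> square z (real n)) \<le> 3 * card (S \<inter> square z (real n))"
      using dense_color_class_square[OF assms] unfolding S_def by blast
    have "card (?V \<inter> square z (real n)) > 0"
      using pos[OF n, of z] by (auto intro!: Nat.gr0I)
    then have "1 / 3 \<le> real (card (S \<inter> square z (real n))) / real (card (?V \<inter> square z (real n)))"
      using z by (simp add: field_simps)
    then have "1 / 3 \<le> ratio S n z"
      by (simp add: ratio_def one_ereal_def)
    also have "\<dots> \<le> (SUP z. ratio S n z)"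
      by (rule SUP_upper) simp
    finally show ?thesis .
  qed
  then have "1 / 3 \<le> limsup (\<lambda>n. SUP z. ratio S n z)"
    using large by (intro le_Limsup) (auto elim!: eventually_mono)
  moreover have "odd_independent_set (triangular_grid p u) S"
    unfolding S_def by (rule odd_independent_grid_color_class[OF assms])
  ultimately have "1 / 3 \<le> odd_independence_density (triangular_grid p u)"
    unfolding dens by (intro SUP_upper2[of S]) auto
  moreover have "odd_independence_density (triangular_grid p u) \<le> 1 / 3"
    unfolding dens by (intro SUP_least) (use upper in auto)
  ultimately show ?thesis by simp
qed

theorem proposition25:
  fixes p u :: complex
  assumes "u \<noteq> 0"
  shows "odd_independence_density (triangular_grid p u) = 1 / 3 \<and>
         strong_odd_chromatic_number (triangular_grid p u) = 3"
  using odd_independence_density_triangular_grid[OF assms]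
    strong_odd_chromatic_number_triangular_grid[OF assms] by blast

end
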